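(* Let $\mathbb G$ be an infinite finitely generated group and let $\mu$ be a finitely supported, symmetric, non-degenerate probability measure on $\mathbb G$ generating a transient random walk. Let $\alpha\in(0,1]$, $\vartheta\in(0,1)$, and let $(F_k)_{k\ge1}$ be an elliptic Hölder exhaustion of type $(\alpha,\vartheta)$ for $\mu$, with constant $C_{EH}$. Write $R_k(a,b):=R(F_k;a,b)$. Then for every $a,b\in\mathbb G$ and for all $k$ large enough that $a,b\in F_k$ and $d(a,b)\le\vartheta R_k(a,b)$, $$\Delta(F_k;a,b)\le C_{EH}\Big(\frac{d(a,b)}{R_k(a,b)}\Big)^{\alpha},$$ and consequently $\Delta(F_k;a,b)\to0$ as $k\to\infty$. In particular, $(\mathbb G,\mu)$ is strong Liouville, i.e. every positive $\mu$-harmonic function on $\mathbb G$ is constant.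
   Context: Non-degenerate: $\operatorname{supp}\mu$ generates $\mathbb G$ as a semigroup; symmetric: $\mu(g)=\mu(g^{-1})$. The Green function of the right random walk is $G(x,y)=\sum_{n\ge0}\mu^{(n)}(x^{-1}y)$, with $\mu^{(n)}$ the $n$-fold convolution power; transient means $G$ is finite. Let $T=\operatorname{supp}\mu$ and let $d$ be the word metric on the Cayley graph of $(\mathbb G,T)$. For a finite non-empty $S\subset\mathbb G$: $\partial S:=\{x\notin S:\ x=yt \text{ for some } y\in S,\ t\in T\}$, $R(S;a,b):=\operatorname{dist}(\{a,b\},\partial S)$ (with respect to $d$), and $$\Delta(S;a,b):=\max_{x\in\partial S}\frac{|G(a,x)-G(b,x)|}{G(a,x)}.$$ A function $u$ is $\mu$-harmonic on a set $F$ if $u(z)=\sum_g\mu(g)u(zg)$ for all $z\in F$. Elliptic Hölder exhaustion of type $(\alpha,\vartheta)$: an increasing exhaustion $(F_k)_{k\ge1}$ of $\mathbb G$ by finite sets for which there exists $C_{EH}>0$ such that for every $k\ge1$, every function $u:\mathbb G\to(0,\infty)$ that is $\mu$-harmonic on $F_k$, and every $a,b\in F_k$ with $d(a,b)\le\vartheta R(F_k;a,b)$, one has $$|u(a)-u(b)|\le C_{EH}\Big(\frac{d(a,b)}{R(F_k;a,b)}\Big)^{\alpha}\min\{u(a),u(b)\}.$$ *)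

theory Defs
  imports "HOL-Algebra.Generated_Groups" "HOL-Probability.Probability"
begin

definition finitely_generated :: "('a, 'm) monoid_scheme \<Rightarrow> bool" where
  "finitely_generated \<G> \<longleftrightarrow>
     (\<exists>A. finite A \<and> A \<subseteq> carrier \<G> \<and> generate \<G> A = carrier \<G>)"

inductive_set semigroup_generated :: "('a, 'm) monoid_scheme \<Rightarrow> 'a set \<Rightarrow> 'a set"
  for \<G> (structure) and T where
  incl: "t \<in> T \<Longrightarrow> t \<in> semigroup_generated \<G> T"
| mult: "x \<in> semigroup_generated \<G> T \<Longrightarrow> y \<in> semigroup_generated \<G> T \<Longrightarrow>
         x \<otimes> y \<in> semigroup_generated \<G> T"

definition non_degenerate :: "('a, 'm) monoid_scheme \<Rightarrow> 'a pmf \<Rightarrow> bool" where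
  "non_degenerate \<G> \<mu> \<longleftrightarrow> semigroup_generated \<G> (set_pmf \<mu>) = carrier \<G>"

definition symmetric_measure :: "('a, 'm) monoid_scheme \<Rightarrow> 'a pmf \<Rightarrow> bool" where
  "symmetric_measure \<G> \<mu> \<longleftrightarrow> (\<forall>g\<in>carrier \<G>. pmf \<mu> g = pmf \<mu> (inv\<^bsub>\<G>\<^esub> g))"

primrec conv_power :: "('a, 'm) monoid_scheme \<Rightarrow> 'a pmf \<Rightarrow> nat \<Rightarrow> 'a pmf" where
  "conv_power \<G> \<mu> 0 = return_pmf \<one>\<^bsub>\<G>\<^esub>"
| "conv_power \<G> \<mu> (Suc n) =
     map_pmf (\<lambda>(x, g). x \<otimes>\<^bsub>\<G>\<^esub> g) (pair_pmf (conv_power \<G> \<mu> n) \<mu>)"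

text \<open>
  As a real-valued series, \<open>green\<close> is meaningful only for transient walks, where
  the series converges for all arguments.
\<close>

definition green :: "('a, 'm) monoid_scheme \<Rightarrow> 'a pmf \<Rightarrow> 'a \<Rightarrow> 'a \<Rightarrow> real" where
  "green \<G> \<mu> x y =
     suminf (\<lambda>n. pmf (conv_power \<G> \<mu> n) (inv\<^bsub>\<G>\<^esub> x \<otimes>\<^bsub>\<G>\<^esub> y))"

definition transient :: "('a, 'm) monoid_scheme \<Rightarrow> 'a pmf \<Rightarrow> bool" where
  "transient \<G> \<mu> \<longleftrightarrow> (\<forall>x\<in>carrier \<G>. \<forall>y\<in>carrier \<G>.
     summable (\<lambda>n. pmf (conv_power \<G> \<mu> n) (inv\<^bsub>\<G>\<^esub> x \<otimes>\<^bsub>\<G>\<^esub> y)))"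

definition cayley_edges :: "('a, 'm) monoid_scheme \<Rightarrow> 'a set \<Rightarrow> ('a \<times> 'a) set" where
  "cayley_edges \<G> T = {(x, x \<otimes>\<^bsub>\<G>\<^esub> t) | x t. x \<in> carrier \<G> \<and> t \<in> T}"

text \<open>
  The edges are directed; for a symmetric set \<open>T\<close> the relation is symmetric.  If \<open>T\<close>
  does not generate, the distance between unconnected points is unspecified.
\<close>

definition word_dist :: "('a, 'm) monoid_scheme \<Rightarrow> 'a pmf \<Rightarrow> 'a \<Rightarrow> 'a \<Rightarrow> nat" where
  "word_dist \<G> \<mu> x y = (LEAST n. (x, y) \<in> cayley_edges \<G> (set_pmf \<mu>) ^^ n)"

definition outer_boundary :: "('a, 'm) monoid_scheme \<Rightarrow> 'a pmf \<Rightarrow> 'a set \<Rightarrow> 'a set" where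
  "outer_boundary \<G> \<mu> S =
     {x \<in> carrier \<G>. x \<notin> S \<and> (\<exists>y\<in>S. \<exists>t\<in>set_pmf \<mu>. x = y \<otimes>\<^bsub>\<G>\<^esub> t)}"

text \<open>
  The minimum and the maximum below range over finite non-empty sets whenever \<open>S\<close> is a
  finite non-empty subset of an infinite group and \<open>\<mu>\<close> is non-degenerate with finite support.
\<close>

definition boundary_dist ::
    "('a, 'm) monoid_scheme \<Rightarrow> 'a pmf \<Rightarrow> 'a set \<Rightarrow> 'a \<Rightarrow> 'a \<Rightarrow> nat" where
  "boundary_dist \<G> \<mu> S a b =
     Min {word_dist \<G> \<mu> c x | c x. c \<in> {a, b} \<and> x \<in> outer_boundary \<G> \<mu> S}"

definition green_osc ::
    "('a, 'm) monoid_scheme \<Rightarrow> 'a pmf \<Rightarrow> 'a set \<Rightarrow> 'a \<Rightarrow> 'a \<Rightarrow> real" where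
  "green_osc \<G> \<mu> S a b =
     Max ((\<lambda>x. \<bar>green \<G> \<mu> a x - green \<G> \<mu> b x\<bar> / green \<G> \<mu> a x) ` outer_boundary \<G> \<mu> S)"

text \<open>
  The sum over the support is only meaningful for finitely supported \<open>\<mu>\<close>: a sum over
  an infinite set would be \<open>0\<close>.  Values of \<open>u\<close> outside the carrier are irrelevant.
\<close>

definition harmonic_on ::
    "('a, 'm) monoid_scheme \<Rightarrow> 'a pmf \<Rightarrow> 'a set \<Rightarrow> ('a \<Rightarrow> real) \<Rightarrow> bool" where
  "harmonic_on \<G> \<mu> F u \<longleftrightarrow>
     (\<forall>z\<in>F. u z = (\<Sum>g\<in>set_pmf \<mu>. pmf \<mu> g * u (z \<otimes>\<^bsub>\<G>\<^esub> g)))"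

definition exhaustion :: "('a, 'm) monoid_scheme \<Rightarrow> (nat \<Rightarrow> 'a set) \<Rightarrow> bool" where
  "exhaustion \<G> F \<longleftrightarrow>
     (\<forall>k\<ge>1. finite (F k) \<and> F k \<subseteq> F (Suc k)) \<and> (\<Union>k\<in>{1..}. F k) = carrier \<G>"

definition elliptic_holder_exhaustion ::
    "('a, 'm) monoid_scheme \<Rightarrow> 'a pmf \<Rightarrow> real \<Rightarrow> real \<Rightarrow> real \<Rightarrow> (nat \<Rightarrow> 'a set) \<Rightarrow> bool" where
  "elliptic_holder_exhaustion \<G> \<mu> \<alpha> \<theta> C F \<longleftrightarrow>
     exhaustion \<G> F \<and> C > 0 \<and>
     (\<forall>k\<ge>1. \<forall>u. (\<forall>x\<in>carrier \<G>. u x > 0) \<longrightarrow> harmonic_on \<G> \<mu> (F k) u \<longrightarrow>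
        (\<forall>a\<in>F k. \<forall>b\<in>F k.
           real (word_dist \<G> \<mu> a b) \<le> \<theta> * real (boundary_dist \<G> \<mu> (F k) a b) \<longrightarrow>
           \<bar>u a - u b\<bar> \<le>
             C * (real (word_dist \<G> \<mu> a b) / real (boundary_dist \<G> \<mu> (F k) a b)) powr \<alpha>
               * min (u a) (u b)))"

definition strong_Liouville :: "('a, 'm) monoid_scheme \<Rightarrow> 'a pmf \<Rightarrow> bool" where
  "strong_Liouville \<G> \<mu> \<longleftrightarrow>
     (\<forall>u. (\<forall>x\<in>carrier \<G>. u x > 0) \<longrightarrow> harmonic_on \<G> \<mu> (carrier \<G>) u \<longrightarrow>
        (\<exists>c. \<forall>x\<in>carrier \<G>. u x = c))"

end

theory Submission
  imports Defs
begin

text \<open>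
  Fix \<open>x\<close> outside the finite set \<open>F\<close>. Decomposing the walk after its first step shows that
  \<open>z \<mapsto> G(z, x)\<close> is harmonic at every \<open>z \<noteq> x\<close>, hence on all of \<open>F\<close>
  (\<open>green_harmonic_off_pole\<close>); by non-degeneracy it is positive (\<open>green_pos\<close>).
  The elliptic Hoelder inequality therefore applies to the Green function with pole at any
  boundary point, and dividing it by \<open>G(a, x)\<close> gives, uniformly in the pole, the bound on
  the oscillation (\<open>green_osc_le\<close>).

  Balls of the word metric are finite, so the sets of an exhaustion eventually swallow every
  ball about \<open>a\<close> and about \<open>b\<close>. Hence the distance from \<open>{a, b}\<close> to the boundary tends to
  infinity (\<open>boundary_dist_at_top\<close>) while \<open>d(a, b)\<close> stays fixed: the smallness condition
  eventually holds, and the right-hand side of the Hoelder inequality tends to \<open>0\<close>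
  (\<open>eventually_admissible\<close>, \<open>holder_ratio_tendsto_0\<close>). This gives the decay of the
  oscillation. Applied to a globally harmonic positive function \<open>u\<close>, the same limit in
  \<open>\<bar>u a - u b\<bar> \<le> C (d / R\<^sub>k)\<^sup>\<alpha> min (u a) (u b)\<close> forces \<open>u a = u b\<close>, which is the strong
  Liouville property.
\<close>

section \<open>Convolution powers and the first-step decomposition\<close>

locale finitely_supported_walk = group \<G> for \<G> :: "('a, 'm) monoid_scheme" (structure) +
  fixes \<mu> :: "'a pmf"
  assumes supp_carrier: "set_pmf \<mu> \<subseteq> carrier \<G>"
    and supp_finite: "finite (set_pmf \<mu>)"
    and generates: "non_degenerate \<G> \<mu>"
begin

abbreviation "E \<equiv> cayley_edges \<G> (set_pmf \<mu>)"

lemma conv_power_Suc_bind: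
  "conv_power \<G> \<mu> (Suc n) = bind_pmf (conv_power \<G> \<mu> n) (\<lambda>x. map_pmf (\<lambda>g. x \<otimes> g) \<mu>)"
  by (simp add: pair_pmf_def map_pmf_def bind_assoc_pmf bind_return_pmf)

lemma conv_power_carrier: "set_pmf (conv_power \<G> \<mu> n) \<subseteq> carrier \<G>"
  using supp_carrier by (induction n) auto

text \<open>
  The powers are built by appending steps on the right, whereas harmonicity in the starting
  point concerns the first step; associativity exchanges the two.
\<close>

lemma conv_power_Suc_left:
  "conv_power \<G> \<mu> (Suc n) = bind_pmf \<mu> (\<lambda>g. map_pmf (\<lambda>x. g \<otimes> x) (conv_power \<G> \<mu> n))"
proof (induction n)
  case 0
  have "map_pmf (\<lambda>g. \<one> \<otimes> g) \<mu> = map_pmf (\<lambda>g. g \<otimes> \<one>) \<mu>"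
    using supp_carrier by (intro map_pmf_cong) auto
  then show ?case
    by (simp add: conv_power_Suc_bind bind_return_pmf map_pmf_def del: conv_power.simps(2))
next
  case (Suc n)
  let ?p = "conv_power \<G> \<mu> n"
  have "conv_power \<G> \<mu> (Suc (Suc n)) =
      bind_pmf (bind_pmf \<mu> (\<lambda>g. map_pmf (\<lambda>x. g \<otimes> x) ?p)) (\<lambda>x. map_pmf (\<lambda>h. x \<otimes> h) \<mu>)"
    by (subst conv_power_Suc_bind, subst Suc) simp
  also have "\<dots> = bind_pmf \<mu> (\<lambda>g. bind_pmf ?p (\<lambda>x. map_pmf (\<lambda>h. (g \<otimes> x) \<otimes> h) \<mu>))"
    by (simp add: bind_assoc_pmf bind_map_pmf)
  also have "\<dots> = bind_pmf \<mu> (\<lambda>g. bind_pmf ?p (\<lambda>x. map_pmf (\<lambda>h. g \<otimes> (x \<otimes> h)) \<mu>))"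
    using supp_carrier conv_power_carrier[of n]
    by (intro bind_pmf_cong map_pmf_cong refl m_assoc) auto
  also have "\<dots> = bind_pmf \<mu> (\<lambda>g. map_pmf (\<lambda>x. g \<otimes> x) (conv_power \<G> \<mu> (Suc n)))"
    by (simp add: conv_power_Suc_bind map_bind_pmf pmf.map_comp o_def del: conv_power.simps(2))
  finally show ?case .
qed

lemma pmf_translate:
  assumes "set_pmf p \<subseteq> carrier \<G>" "g \<in> carrier \<G>" "y \<in> carrier \<G>"
  shows "pmf (map_pmf (\<lambda>x. g \<otimes> x) p) y = pmf p (inv g \<otimes> y)"
proof -
  have "(\<lambda>x. g \<otimes> x) -` {y} \<inter> set_pmf p = {inv g \<otimes> y} \<inter> set_pmf p"
  proof (intro equalityI subsetI)
    fix x assume "x \<in> (\<lambda>x. g \<otimes> x) -` {y} \<inter> set_pmf p"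
    then show "x \<in> {inv g \<otimes> y} \<inter> set_pmf p"
      using assms inv_solve_left[of x g y] by auto
  next
    fix x assume "x \<in> {inv g \<otimes> y} \<inter> set_pmf p"
    then show "x \<in> (\<lambda>x. g \<otimes> x) -` {y} \<inter> set_pmf p"
      using assms inv_solve_left[of x g y] by auto
  qed
  then have "measure p ((\<lambda>x. g \<otimes> x) -` {y}) = measure p {inv g \<otimes> y}"
    by (metis measure_Int_set_pmf)
  then show ?thesis
    by (simp add: pmf_map measure_pmf_single)
qed

lemma pmf_conv_power_Suc:
  assumes "y \<in> carrier \<G>"
  shows "pmf (conv_power \<G> \<mu> (Suc n)) y =
    (\<Sum>g\<in>set_pmf \<mu>. pmf \<mu> g * pmf (conv_power \<G> \<mu> n) (inv g \<otimes> y))"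
proof -
  have "pmf (conv_power \<G> \<mu> (Suc n)) y =
      (\<Sum>g\<in>set_pmf \<mu>. pmf \<mu> g * pmf (map_pmf (\<lambda>x. g \<otimes> x) (conv_power \<G> \<mu> n)) y)"
    unfolding conv_power_Suc_left pmf_bind
    by (subst integral_measure_pmf[OF supp_finite]) auto
  also have "\<dots> = (\<Sum>g\<in>set_pmf \<mu>. pmf \<mu> g * pmf (conv_power \<G> \<mu> n) (inv g \<otimes> y))"
    using supp_carrier assms conv_power_carrier
    by (intro sum.cong refl) (subst pmf_translate; auto)
  finally show ?thesis .
qed

section \<open>The Cayley graph\<close>

lemma edges_carrier: "(x, y) \<in> E\<^sup>* \<Longrightarrow> x \<in> carrier \<G> \<Longrightarrow> y \<in> carrier \<G>"
  by (induction rule: rtrancl_induct) (use supp_carrier in \<open>auto simp: cayley_edges_def\<close>)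

lemma semigroup_generated_reachable:
  assumes "s \<in> semigroup_generated \<G> (set_pmf \<mu>)" "x \<in> carrier \<G>"
  shows "(x, x \<otimes> s) \<in> E\<^sup>*"
  using assms
proof (induction arbitrary: x rule: semigroup_generated.induct)
  case (incl t)
  then show ?case by (auto simp: cayley_edges_def)
next
  case (mult s t)
  have "s \<in> carrier \<G>" "t \<in> carrier \<G>"
    using mult.hyps generates by (auto simp: non_degenerate_def)
  with mult.IH(1)[of x] mult.IH(2)[of "x \<otimes> s"] mult.prems show ?case
    by (auto simp: m_assoc)
qed

lemma reachable:
  assumes "x \<in> carrier \<G>" "y \<in> carrier \<G>"
  shows "(x, y) \<in> E\<^sup>*"
proof -
  have "inv x \<otimes> y \<in> semigroup_generated \<G> (set_pmf \<mu>)"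
    using generates assms by (simp add: non_degenerate_def)
  from semigroup_generated_reachable[OF this assms(1)] assms show ?thesis
    by (simp add: m_assoc[symmetric])
qed

lemma path_increment_in_supp:
  assumes "(x, y) \<in> E ^^ n" "x \<in> carrier \<G>"
  shows "inv x \<otimes> y \<in> set_pmf (conv_power \<G> \<mu> n)"
  using assms
proof (induction n arbitrary: y)
  case (Suc n)
  then obtain w t where w: "(x, w) \<in> E ^^ n" and t: "t \<in> set_pmf \<mu>" "y = w \<otimes> t"
    by (auto simp: cayley_edges_def)
  have "w \<in> carrier \<G>"
    using w Suc.prems(2) edges_carrier by (blast intro: relpow_imp_rtrancl)
  then have "inv x \<otimes> y = (inv x \<otimes> w) \<otimes> t"
    using t Suc.prems(2) supp_carrier by (auto simp: m_assoc)
  with Suc.IH[OF w Suc.prems(2)] t(1) show ?case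
    by force
qed auto

lemma word_dist_path:
  assumes "x \<in> carrier \<G>" "y \<in> carrier \<G>"
  shows "(x, y) \<in> E ^^ word_dist \<G> \<mu> x y"
proof -
  obtain n where "(x, y) \<in> E ^^ n"
    using reachable[OF assms] by (auto simp: rtrancl_power)
  then show ?thesis
    unfolding word_dist_def by (rule LeastI)
qed

lemma finite_sphere: "finite {y. (x, y) \<in> E ^^ n}"
proof (induction n)
  case (Suc n)
  have "{y. (x, y) \<in> E ^^ Suc n} \<subseteq> (\<lambda>(w, t). w \<otimes> t) ` ({y. (x, y) \<in> E ^^ n} \<times> set_pmf \<mu>)"
    by (force simp: cayley_edges_def)
  then show ?case
    using Suc supp_finite by (blast intro: finite_subset)
qed simp

lemma finite_ball:
  assumes "x \<in> carrier \<G>"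
  shows "finite {y \<in> carrier \<G>. word_dist \<G> \<mu> x y \<le> n}"
proof (rule finite_subset)
  show "{y \<in> carrier \<G>. word_dist \<G> \<mu> x y \<le> n} \<subseteq> (\<Union>m\<le>n. {y. (x, y) \<in> E ^^ m})"
    using word_dist_path[OF assms] by auto
qed (auto intro: finite_sphere)

lemma finite_outer_boundary:
  assumes "finite S"
  shows "finite (outer_boundary \<G> \<mu> S)"
proof (rule finite_subset)
  show "outer_boundary \<G> \<mu> S \<subseteq> (\<lambda>(y, t). y \<otimes> t) ` (S \<times> set_pmf \<mu>)"
    by (force simp: outer_boundary_def)
qed (use assms supp_finite in auto)

text \<open>
  A set without outer boundary is closed under the edges of a connected graph; if non-empty, it
  is then the whole group and cannot be finite.
\<close>

lemma outer_boundary_nonempty: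
  assumes "infinite (carrier \<G>)" "finite S" "S \<subseteq> carrier \<G>" "y \<in> S"
  shows "outer_boundary \<G> \<mu> S \<noteq> {}"
proof
  assume empty: "outer_boundary \<G> \<mu> S = {}"
  have closed: "z \<in> S" if "(y, z) \<in> E\<^sup>*" for z
    using that
  proof (induction rule: rtrancl_induct)
    case (step v w)
    then obtain t where "t \<in> set_pmf \<mu>" "w = v \<otimes> t" "v \<in> carrier \<G>"
      by (auto simp: cayley_edges_def)
    with step.IH empty supp_carrier show ?case
      unfolding outer_boundary_def by blast
  qed (rule assms)
  have "carrier \<G> \<subseteq> S"
    using closed reachable assms(3,4) by blast
  then show False
    using assms(1,2) finite_subset by blast
qed

lemma boundary_dist_attained:
  assumes "finite S" "outer_boundary \<G> \<mu> S \<noteq> {}"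
  obtains c x where "c \<in> {a, b}" "x \<in> outer_boundary \<G> \<mu> S"
    "boundary_dist \<G> \<mu> S a b = word_dist \<G> \<mu> c x"
proof -
  let ?D = "{word_dist \<G> \<mu> c x | c x. c \<in> {a, b} \<and> x \<in> outer_boundary \<G> \<mu> S}"
  have "?D = (\<lambda>(c, x). word_dist \<G> \<mu> c x) ` ({a, b} \<times> outer_boundary \<G> \<mu> S)"
    by (auto simp: image_iff)
  then have "finite ?D" "?D \<noteq> {}"
    using finite_outer_boundary[OF assms(1)] assms(2) by auto
  from Min_in[OF this] show ?thesis
    using that unfolding boundary_dist_def by blast
qed

section \<open>The Green function\<close>

text \<open>
  The time-zero term of the series is the only obstruction to harmonicity, and it vanishes away
  from the pole.
\<close>

lemma green_harmonic_off_pole: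
  assumes "transient \<G> \<mu>" "z \<in> carrier \<G>" "x \<in> carrier \<G>" "z \<noteq> x"
  shows "green \<G> \<mu> z x = (\<Sum>g\<in>set_pmf \<mu>. pmf \<mu> g * green \<G> \<mu> (z \<otimes> g) x)"
proof -
  let ?p = "\<lambda>n y. pmf (conv_power \<G> \<mu> n) y"
  have inv_step: "inv g \<otimes> (inv z \<otimes> x) = inv (z \<otimes> g) \<otimes> x" if "g \<in> set_pmf \<mu>" for g
    using that supp_carrier assms by (auto simp: inv_mult_group m_assoc)
  have summ: "summable (\<lambda>n. ?p n (inv w \<otimes> x))" if "w \<in> carrier \<G>" for w
    using assms that by (auto simp: transient_def)
  have "inv z \<otimes> x \<noteq> \<one>"
    using assms by (metis inv_closed inv_equality inv_inv)
  then have "?p 0 (inv z \<otimes> x) = 0"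
    by simp
  with suminf_split_head[OF summ[OF assms(2)]]
  have "green \<G> \<mu> z x = (\<Sum>n. ?p (Suc n) (inv z \<otimes> x))"
    unfolding green_def by linarith
  also have "\<dots> = (\<Sum>n. \<Sum>g\<in>set_pmf \<mu>. pmf \<mu> g * ?p n (inv (z \<otimes> g) \<otimes> x))"
    using assms by (subst pmf_conv_power_Suc) (auto simp: inv_step cong: sum.cong)
  also have "\<dots> = (\<Sum>g\<in>set_pmf \<mu>. \<Sum>n. pmf \<mu> g * ?p n (inv (z \<otimes> g) \<otimes> x))"
    using supp_carrier assms(2) by (intro suminf_sum summable_mult summ) auto
  also have "\<dots> = (\<Sum>g\<in>set_pmf \<mu>. pmf \<mu> g * green \<G> \<mu> (z \<otimes> g) x)"
    unfolding green_def
    using supp_carrier assms(2) by (intro sum.cong refl suminf_mult summ) auto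
  finally show ?thesis .
qed

lemma green_pos:
  assumes "transient \<G> \<mu>" "z \<in> carrier \<G>" "x \<in> carrier \<G>"
  shows "green \<G> \<mu> z x > 0"
proof -
  have "pmf (conv_power \<G> \<mu> (word_dist \<G> \<mu> z x)) (inv z \<otimes> x) > 0"
    using path_increment_in_supp[OF word_dist_path] assms by (simp add: pmf_positive)
  moreover have "summable (\<lambda>n. pmf (conv_power \<G> \<mu> n) (inv z \<otimes> x))"
    using assms by (auto simp: transient_def)
  ultimately show ?thesis
    unfolding green_def by (intro suminf_pos2) auto
qed

section \<open>Exhaustions\<close>

lemma exhaustion_props:
  assumes "exhaustion \<G> F" "k \<ge> 1"
  shows "finite (F k)" "F k \<subseteq> carrier \<G>"
  using assms unfolding exhaustion_def by auto

lemma exhaustion_eventually_contains: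
  assumes "exhaustion \<G> F" "finite A" "A \<subseteq> carrier \<G>"
  shows "eventually (\<lambda>k. A \<subseteq> F k) sequentially"
proof -
  have "eventually (\<lambda>k. x \<in> F k) sequentially" if x: "x \<in> A" for x
  proof -
    have "x \<in> (\<Union>k\<in>{1..}. F k)"
      using assms x by (auto simp: exhaustion_def)
    then obtain m where m: "m \<ge> 1" "x \<in> F m"
      by auto
    have "x \<in> F k" if "k \<ge> m" for k
      using that
    proof (induction k rule: dec_induct)
      case (step n)
      then show ?case
        using assms(1) m(1) unfolding exhaustion_def by (meson le_trans subsetD)
    qed (rule m)
    then show ?thesis
      by (auto simp: eventually_sequentially)
  qed
  then have "eventually (\<lambda>k. \<forall>x\<in>A. x \<in> F k) sequentially"
    using assms(2) by (simp add: eventually_ball_finite)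
  then show ?thesis
    by (simp add: subset_iff Ball_def)
qed

lemma boundary_dist_at_top:
  assumes "infinite (carrier \<G>)" "exhaustion \<G> F" "a \<in> carrier \<G>" "b \<in> carrier \<G>"
  shows "filterlim (\<lambda>k. boundary_dist \<G> \<mu> (F k) a b) at_top sequentially"
  unfolding filterlim_at_top
proof
  fix n
  \<comment> \<open>The two balls of radius \<open>n\<close>; adding \<open>a\<close> makes \<open>F k\<close> visibly non-empty, so that its outer
    boundary is non-empty and the minimum defining the distance is attained.\<close>
  let ?B = "{a} \<union> (\<Union>c\<in>{a, b}. {y \<in> carrier \<G>. word_dist \<G> \<mu> c y \<le> n})"
  have "eventually (\<lambda>k. ?B \<subseteq> F k) sequentially"
    using assms finite_ball by (intro exhaustion_eventually_contains) auto
  with eventually_ge_at_top[of 1]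
  show "eventually (\<lambda>k. n \<le> boundary_dist \<G> \<mu> (F k) a b) sequentially"
  proof eventually_elim
    case (elim k)
    note fin = exhaustion_props[OF assms(2) elim(1)]
    have "outer_boundary \<G> \<mu> (F k) \<noteq> {}"
      using outer_boundary_nonempty[OF assms(1) fin, of a] elim(2) by auto
    then obtain c x where "c \<in> {a, b}" "x \<in> outer_boundary \<G> \<mu> (F k)"
      "boundary_dist \<G> \<mu> (F k) a b = word_dist \<G> \<mu> c x"
      using boundary_dist_attained[OF fin(1)] by blast
    with elim(2) show ?case
      by (fastforce simp: outer_boundary_def)
  qed
qed

lemma eventually_admissible:
  fixes \<theta> :: real
  assumes "infinite (carrier \<G>)" "exhaustion \<G> F" "a \<in> carrier \<G>" "b \<in> carrier \<G>" "\<theta> > 0"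
  shows "eventually (\<lambda>k. k \<ge> 1 \<and> a \<in> F k \<and> b \<in> F k \<and>
    real (word_dist \<G> \<mu> a b) \<le> \<theta> * real (boundary_dist \<G> \<mu> (F k) a b)) sequentially"
proof -
  have "filterlim (\<lambda>k. real (boundary_dist \<G> \<mu> (F k) a b)) at_top sequentially"
    by (rule filterlim_compose[OF filterlim_real_sequentially boundary_dist_at_top[OF assms(1-4)]])
  then have "eventually (\<lambda>k. real (word_dist \<G> \<mu> a b) / \<theta>
      \<le> real (boundary_dist \<G> \<mu> (F k) a b)) sequentially"
    by (simp add: filterlim_at_top)
  moreover have "eventually (\<lambda>k. {a, b} \<subseteq> F k) sequentially"
    using assms by (intro exhaustion_eventually_contains) auto
  ultimately show ?thesis
    using eventually_ge_at_top[of 1]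
    by eventually_elim (use assms(5) in \<open>auto simp: field_simps\<close>)
qed

lemma holder_ratio_tendsto_0:
  fixes C \<alpha> :: real
  assumes "infinite (carrier \<G>)" "exhaustion \<G> F" "a \<in> carrier \<G>" "b \<in> carrier \<G>" "\<alpha> > 0"
  shows "(\<lambda>k. C * (real (word_dist \<G> \<mu> a b) / real (boundary_dist \<G> \<mu> (F k) a b)) powr \<alpha>)
    \<longlonglongrightarrow> 0"
proof -
  have "filterlim (\<lambda>k. real (boundary_dist \<G> \<mu> (F k) a b)) at_top sequentially"
    by (rule filterlim_compose[OF filterlim_real_sequentially boundary_dist_at_top[OF assms(1-4)]])
  then have "(\<lambda>k. real (word_dist \<G> \<mu> a b) / real (boundary_dist \<G> \<mu> (F k) a b)) \<longlonglongrightarrow> 0"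
    by (rule real_tendsto_divide_at_top[OF tendsto_const])
  then have "(\<lambda>k. (real (word_dist \<G> \<mu> a b) / real (boundary_dist \<G> \<mu> (F k) a b)) powr \<alpha>)
      \<longlonglongrightarrow> 0"
    using assms(5) by (intro tendsto_zero_powrI[of _ _ _ \<alpha>]) auto
  then show ?thesis
    by (rule tendsto_mult_right_zero)
qed

section \<open>Oscillation of the Green function and the strong Liouville property\<close>

lemma green_osc_le:
  assumes "infinite (carrier \<G>)" "transient \<G> \<mu>" "elliptic_holder_exhaustion \<G> \<mu> \<alpha> \<theta> C F"
    and "k \<ge> 1" "a \<in> F k" "b \<in> F k"
    and "real (word_dist \<G> \<mu> a b) \<le> \<theta> * real (boundary_dist \<G> \<mu> (F k) a b)"
  shows "green_osc \<G> \<mu> (F k) a b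
    \<le> C * (real (word_dist \<G> \<mu> a b) / real (boundary_dist \<G> \<mu> (F k) a b)) powr \<alpha>"
    (is "_ \<le> ?H")
proof -
  have exh: "exhaustion \<G> F"
    using assms(3) by (simp add: elliptic_holder_exhaustion_def)
  have holder: "\<bar>u a - u b\<bar> \<le> ?H * min (u a) (u b)"
      if "\<forall>x\<in>carrier \<G>. u x > 0" "harmonic_on \<G> \<mu> (F k) u" for u
    using assms(3-7) that unfolding elliptic_holder_exhaustion_def by blast
  have H: "?H \<ge> 0"
    using assms(3) by (simp add: elliptic_holder_exhaustion_def)
  note fin = exhaustion_props[OF exh assms(4)]
  have "\<bar>green \<G> \<mu> a x - green \<G> \<mu> b x\<bar> / green \<G> \<mu> a x \<le> ?H"
    if x: "x \<in> outer_boundary \<G> \<mu> (F k)" for x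
  proof -
    have x': "x \<in> carrier \<G>" "x \<notin> F k"
      using x by (auto simp: outer_boundary_def)
    have "harmonic_on \<G> \<mu> (F k) (\<lambda>z. green \<G> \<mu> z x)"
      unfolding harmonic_on_def using green_harmonic_off_pole[OF assms(2)] x' fin(2) by blast
    then have "\<bar>green \<G> \<mu> a x - green \<G> \<mu> b x\<bar> \<le> ?H * min (green \<G> \<mu> a x) (green \<G> \<mu> b x)"
      using x' green_pos[OF assms(2)] by (intro holder) auto
    also have "\<dots> \<le> ?H * green \<G> \<mu> a x"
      using H by (intro mult_left_mono) auto
    finally show ?thesis
      using green_pos[OF assms(2) _ x'(1), of a] assms(5) fin(2)
      by (subst pos_divide_le_eq) auto
  qed
  then show ?thesis
    unfolding green_osc_def
    using finite_outer_boundary[OF fin(1)] outer_boundary_nonempty[OF assms(1) fin assms(5)]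
    by (subst Max_le_iff) auto
qed

lemma green_osc_nonneg:
  assumes "infinite (carrier \<G>)" "transient \<G> \<mu>" "exhaustion \<G> F" "k \<ge> 1" "a \<in> F k"
  shows "0 \<le> green_osc \<G> \<mu> (F k) a b"
proof -
  note fin = exhaustion_props[OF assms(3,4)]
  obtain x where x: "x \<in> outer_boundary \<G> \<mu> (F k)"
    using outer_boundary_nonempty[OF assms(1) fin assms(5)] by blast
  then have "green \<G> \<mu> a x > 0"
    using assms(5) fin(2) by (intro green_pos assms(2)) (auto simp: outer_boundary_def)
  then have "0 \<le> \<bar>green \<G> \<mu> a x - green \<G> \<mu> b x\<bar> / green \<G> \<mu> a x"
    by simp
  also have "\<dots> \<le> green_osc \<G> \<mu> (F k) a b"
    unfolding green_osc_def using finite_outer_boundary[OF fin(1)] x by (intro Max_ge) auto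
  finally show ?thesis .
qed

lemma green_osc_tendsto_0:
  assumes "infinite (carrier \<G>)" "transient \<G> \<mu>" "elliptic_holder_exhaustion \<G> \<mu> \<alpha> \<theta> C F"
    and "\<alpha> > 0" "\<theta> > 0" "a \<in> carrier \<G>" "b \<in> carrier \<G>"
  shows "(\<lambda>k. green_osc \<G> \<mu> (F k) a b) \<longlonglongrightarrow> 0"
proof -
  have exh: "exhaustion \<G> F"
    using assms(3) by (simp add: elliptic_holder_exhaustion_def)
  note adm = eventually_admissible[OF assms(1) exh assms(6,7,5)]
  show ?thesis
  proof (rule tendsto_sandwich[OF _ _ tendsto_const
        holder_ratio_tendsto_0[OF assms(1) exh assms(6,7,4), of C]])
    show "eventually (\<lambda>k. 0 \<le> green_osc \<G> \<mu> (F k) a b) sequentially"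
      using adm by eventually_elim (use green_osc_nonneg[OF assms(1,2) exh] in auto)
    show "eventually (\<lambda>k. green_osc \<G> \<mu> (F k) a b
        \<le> C * (real (word_dist \<G> \<mu> a b) / real (boundary_dist \<G> \<mu> (F k) a b)) powr \<alpha>) sequentially"
      using adm by eventually_elim (use green_osc_le[OF assms(1-3)] in auto)
  qed
qed

lemma elliptic_holder_strong_Liouville:
  assumes "infinite (carrier \<G>)" "elliptic_holder_exhaustion \<G> \<mu> \<alpha> \<theta> C F" "\<alpha> > 0" "\<theta> > 0"
  shows "strong_Liouville \<G> \<mu>"
  unfolding strong_Liouville_def
proof (intro allI impI)
  fix u assume pos: "\<forall>x\<in>carrier \<G>. u x > 0" and harm: "harmonic_on \<G> \<mu> (carrier \<G>) u"
  have exh: "exhaustion \<G> F"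
    using assms(2) by (simp add: elliptic_holder_exhaustion_def)
  have "u a = u b" if ab: "a \<in> carrier \<G>" "b \<in> carrier \<G>" for a b
  proof -
    let ?H = "\<lambda>k. C * (real (word_dist \<G> \<mu> a b) / real (boundary_dist \<G> \<mu> (F k) a b)) powr \<alpha>"
    have "eventually (\<lambda>k. \<bar>u a - u b\<bar> \<le> ?H k * min (u a) (u b)) sequentially"
      using eventually_admissible[OF assms(1) exh ab assms(4)]
    proof eventually_elim
      case (elim k)
      have "harmonic_on \<G> \<mu> (F k) u"
        using harm exhaustion_props(2)[OF exh, of k] elim unfolding harmonic_on_def by blast
      then show ?case
        using assms(2) elim pos unfolding elliptic_holder_exhaustion_def by blast
    qed
    moreover have "(\<lambda>k. ?H k * min (u a) (u b)) \<longlonglongrightarrow> 0"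
      by (rule tendsto_mult_left_zero[OF holder_ratio_tendsto_0[OF assms(1) exh ab assms(3)]])
    ultimately have "\<bar>u a - u b\<bar> \<le> 0"
      by (intro tendsto_lowerbound[of _ _ sequentially]) auto
    then show ?thesis
      by simp
  qed
  then show "\<exists>c. \<forall>x\<in>carrier \<G>. u x = c"
    by blast
qed

end

theorem theoremC:
  fixes \<G> :: "('a, 'm) monoid_scheme" and \<mu> :: "'a pmf"
    and \<alpha> \<theta> C :: real and F :: "nat \<Rightarrow> 'a set"
  assumes "group \<G>" and "infinite (carrier \<G>)" and "finitely_generated \<G>"
    and "set_pmf \<mu> \<subseteq> carrier \<G>" and "finite (set_pmf \<mu>)"
    and "symmetric_measure \<G> \<mu>" and "non_degenerate \<G> \<mu>" and "transient \<G> \<mu>"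
    and "0 < \<alpha>" and "\<alpha> \<le> 1" and "0 < \<theta>" and "\<theta> < 1"
    and "elliptic_holder_exhaustion \<G> \<mu> \<alpha> \<theta> C F"
  shows "(\<forall>a\<in>carrier \<G>. \<forall>b\<in>carrier \<G>.
           (\<forall>k\<ge>1. a \<in> F k \<longrightarrow> b \<in> F k \<longrightarrow>
              real (word_dist \<G> \<mu> a b) \<le> \<theta> * real (boundary_dist \<G> \<mu> (F k) a b) \<longrightarrow>
              green_osc \<G> \<mu> (F k) a b
                \<le> C * (real (word_dist \<G> \<mu> a b) / real (boundary_dist \<G> \<mu> (F k) a b)) powr \<alpha>) \<and>
           ((\<lambda>k. green_osc \<G> \<mu> (F k) a b) \<longlonglongrightarrow> 0)) \<and>
         strong_Liouville \<G> \<mu>"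
proof -
  interpret finitely_supported_walk \<G> \<mu>
    using assms by (simp add: finitely_supported_walk_def finitely_supported_walk_axioms_def)
  show ?thesis
    by (intro conjI ballI allI impI green_osc_le[OF assms(2,8,13)]
        green_osc_tendsto_0[OF assms(2,8,13,9,11)]
        elliptic_holder_strong_Liouville[OF assms(2,13,9,11)])
qed

end
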